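(* Let $a_1,a_2,a_3,a_4,b_1,b_2,b_3,b_4\in\mathbb{R}$ and consider the ODE on $\mathbb{R}^2$ $$\dot u = e^{a_1 u+b_1 v}-e^{a_2 u+b_2 v},\qquad \dot v = e^{a_3 u+b_3 v}-e^{a_4 u+b_4 v},$$ whose Jacobian matrix at the origin is $J=\begin{pmatrix} a_1-a_2 & b_1-b_2\\ a_3-a_4 & b_3-b_4\end{pmatrix}$. Assume that $\det J>0$ and further that either (A) or (B) below holds. (A) $\operatorname{sgn} J=\begin{pmatrix} * & -\\ + & *\end{pmatrix}$, $\ a_4\le\min(a_1,a_2)\le\max(a_1,a_2)\le a_3$, and $b_1\le\min(b_3,b_4)\le\max(b_3,b_4)\le b_2$. (B) $\operatorname{sgn} J=\begin{pmatrix} * & +\\ - & *\end{pmatrix}$, $\ a_3\le\min(a_1,a_2)\le\max(a_1,a_2)\le a_4$, and $b_2\le\min(b_3,b_4)\le\max(b_3,b_4)\le b_1$. In case (A), let $$L_\infty=(a_3-a_1)(b_2-b_3)(a_2-a_4)(b_4-b_1)-(b_1-b_3)(a_2-a_3)(b_4-b_2)(a_4-a_1),$$ while in case (B), let $$L_\infty=(b_1-b_3)(a_2-a_3)(b_4-b_2)(a_4-a_1)-(a_3-a_1)(b_2-b_3)(a_2-a_4)(b_4-b_1).$$ Then the following two statements hold. (i) If $L_\infty>0$ then the ODE is permanent. (ii) If $L_\infty<0$ then the ODE is not permanent.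
   Context: The ODE is called permanent if there exists a compact subset of $\mathbb{R}^2$ that is forward invariant and is a global attractor (it attracts every point of $\mathbb{R}^2$). The sign $\operatorname{sgn}$ of a matrix is taken entrywise; $*$ stands for an arbitrary sign (no condition on that entry). *)

theory Defs
  imports "HOL-Analysis.Analysis"
begin

definition solves_ode_on ::
  "('a::real_normed_vector \<Rightarrow> 'a) \<Rightarrow> real set \<Rightarrow> (real \<Rightarrow> 'a) \<Rightarrow> bool"
  where "solves_ode_on f I x \<longleftrightarrow>
    (\<forall>t\<in>I. (x has_vector_derivative f (x t)) (at t within I))"

text \<open>Solutions on arbitrary compact time intervals are considered, so that
  solutions that blow up in finite time are covered as well.\<close>

definition forward_invariant ::
  "('a::real_normed_vector \<Rightarrow> 'a) \<Rightarrow> 'a set \<Rightarrow> bool"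
  where "forward_invariant f K \<longleftrightarrow>
    (\<forall>T\<ge>0. \<forall>x. solves_ode_on f {0..T} x \<and> x 0 \<in> K \<longrightarrow> (\<forall>t\<in>{0..T}. x t \<in> K))"

text \<open>Attraction of a point includes that the forward solution starting there
  exists for all positive times.\<close>

definition attracts_point ::
  "('a::real_normed_vector \<Rightarrow> 'a) \<Rightarrow> 'a set \<Rightarrow> 'a \<Rightarrow> bool"
  where "attracts_point f K p \<longleftrightarrow>
    (\<exists>x. solves_ode_on f {0..} x \<and> x 0 = p) \<and>
    (\<forall>x. solves_ode_on f {0..} x \<and> x 0 = p \<longrightarrow>
      ((\<lambda>t. infdist (x t) K) \<longlongrightarrow> 0) at_top)"

text \<open>Nonemptiness is stated explicitly because the distance to the empty set,
  as given by \<^const>\<open>infdist\<close>, is \<open>0\<close>.\<close>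

definition permanent :: "('a::real_normed_vector \<Rightarrow> 'a) \<Rightarrow> bool"
  where "permanent f \<longleftrightarrow>
    (\<exists>K. compact K \<and> K \<noteq> {} \<and> forward_invariant f K \<and> (\<forall>p. attracts_point f K p))"

definition exp_field ::
  "real \<Rightarrow> real \<Rightarrow> real \<Rightarrow> real \<Rightarrow> real \<Rightarrow> real \<Rightarrow> real \<Rightarrow> real \<Rightarrow> real^2 \<Rightarrow> real^2"
  where "exp_field a1 a2 a3 a4 b1 b2 b3 b4 p =
    vector [exp (a1 * p$1 + b1 * p$2) - exp (a2 * p$1 + b2 * p$2),
            exp (a3 * p$1 + b3 * p$2) - exp (a4 * p$1 + b4 * p$2)]"

definition exp_field_jacobian ::
  "real \<Rightarrow> real \<Rightarrow> real \<Rightarrow> real \<Rightarrow> real \<Rightarrow> real \<Rightarrow> real \<Rightarrow> real \<Rightarrow> real^2^2"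
  where "exp_field_jacobian a1 a2 a3 a4 b1 b2 b3 b4 =
    vector [vector [a1 - a2, b1 - b2],
            vector [a3 - a4, b3 - b4]]"

lemma exp_field_has_derivative_origin:
  "(exp_field a1 a2 a3 a4 b1 b2 b3 b4 has_derivative
     (\<lambda>h. exp_field_jacobian a1 a2 a3 a4 b1 b2 b3 b4 *v h)) (at 0)"
proof -
  have comp: "((\<lambda>p::real^2. exp (a * p$1 + b * p$2) - exp (c * p$1 + d * p$2))
      has_derivative (\<lambda>h. (a - c) * h$1 + (b - d) * h$2)) (at 0)" for a b c d :: real
    by (auto intro!: derivative_eq_intros bounded_linear_imp_has_derivative
        bounded_linear_vec_nth simp: algebra_simps)
  have "((\<lambda>p. exp_field a1 a2 a3 a4 b1 b2 b3 b4 p $ i) has_derivative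
      (\<lambda>h. (exp_field_jacobian a1 a2 a3 a4 b1 b2 b3 b4 *v h) $ i)) (at 0)" for i
    using exhaust_2[of i] comp[of a1 b1 a2 b2] comp[of a3 b3 a4 b4]
    by (auto simp: exp_field_def exp_field_jacobian_def matrix_vector_mult_def sum_2)
  then show ?thesis
    by (subst has_derivative_componentwise_within)
      (auto simp: Basis_vec_def inner_axis)
qed

end

theory Submission
  imports Defs
begin

text \<open>
  In case (A) the flow far from the origin turns counterclockwise. At a point of size \<open>r\<close> the four
  monomials differ by factors \<open>exp (c * r)\<close>, so in each quadrant one term of each equation
  decides, and an orbit of the truncated system runs along two sides of a right angle: it comes in
  parallel to one axis and leaves parallel to the other. If \<open>U\<close>, \<open>V\<close>, \<open>W\<close>, \<open>Z\<close> are the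
  distances from the axes at which it passes on the right, above, on the left and below, the four
  quadrants give
  \<open>U = (b3 - b1) / (a3 - a1) * Z\<close>, \<open>V = (a3 - a2) / (b2 - b3) * U\<close>, \<open>W = (b2 - b4) / (a2 - a4) * V\<close>
  and \<open>Z = (a1 - a4) / (b4 - b1) * W\<close>. One turn is a contraction when the product of the four
  ratios is below 1, and with the denominators cleared this is the condition \<open>L_inf > 0\<close>.

  If the product is below 1, the four numbers can be chosen slightly larger than what the orbits ask
  for (\<open>cyclic_ratios\<close>), and then the flow crosses every large multiple of the box
  \<open>{-W..U} \<times> {-Z..V}\<close> inwards, once the box is tilted a little against the rotation: along the right
  side, for example, the outward motion before the nullcline is exponentially slow compared with the
  upward motion, and any fixed tilt outweighs it (\<open>side_dominance\<close>, \<open>tilted_side_inward\<close>,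
  \<open>crosses_inward_counterclockwise\<close>). The largest of the four linear functionals that define the box is
  thus a proper Lyapunov function outside a compact set, and permanence follows
  (\<open>permanent_if_crosses_inward\<close>): large sublevel sets are forward invariant, so that solutions exist for all
  times, and by compactness the functional falls with a positive rate until the orbit is in the smallest
  polygon.

  The other three cases are symmetric. The reflection \<open>u \<mapsto> -u\<close> exchanges (A) and (B) and
  keeps \<open>L_inf\<close>. Time reversal exchanges (A) and (B) and changes the sign of \<open>L_inf\<close>, so for
  \<open>L_inf < 0\<close> it is the reversed flow that crosses large boxes inwards. Orbits of the given
  system that start outside a large box then never enter it, which excludes a compact attractor
  (\<open>not_permanent_if_crosses_outward\<close>).
\<close>

section \<open>Comparison and global existence\<close>

text \<open>
  The maximum of the functions need not be differentiable, but only those that attain it can push it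
  above \<open>c\<close>. At the last time before \<open>t\<close> at which all of them are at most \<open>c\<close>, the ones equal to \<open>c\<close>
  decrease and the others remain below \<open>c\<close> by continuity, so that this time is not the last one.
\<close>

lemma family_stays_below:
  fixes g g' :: "'i \<Rightarrow> real \<Rightarrow> real"
  assumes fin: "finite I"
    and der: "\<And>i t. i \<in> I \<Longrightarrow> t \<in> {a..b} \<Longrightarrow> (g i has_real_derivative g' i t) (at t within {a..b})"
    and init: "\<And>i. i \<in> I \<Longrightarrow> g i a \<le> c"
    and active: "\<And>i t. i \<in> I \<Longrightarrow> t \<in> {a..b} \<Longrightarrow> g i t = c \<Longrightarrow> \<forall>j\<in>I. g j t \<le> c \<Longrightarrow> g' i t < 0"
    and i: "i \<in> I" and t: "t \<in> {a..b}"
  shows "g i t \<le> c"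
proof (rule ccontr)
  assume above: "\<not> g i t \<le> c"
  define B where "B = {a..t} \<inter> (\<Inter>j\<in>I. {r \<in> {a..b}. g j r \<le> c})"
  define s where "s = Sup B"
  have cont: "continuous_on {a..b} (g j)" if "j \<in> I" for j
    using der[OF that] by (meson DERIV_continuous_on)
  have "compact B"
    unfolding B_def using cont
    by (intro compact_Int_closed closed_INT ballI continuous_on_closed_Collect_le) auto
  moreover have "a \<in> B"
    using init t by (auto simp: B_def)
  ultimately have sB: "s \<in> B"
    unfolding s_def by (intro closed_contains_Sup compact_imp_closed bounded_imp_bdd_above compact_imp_bounded) auto
  have upper: "r \<le> s" if "r \<in> B" for r
    unfolding s_def using \<open>compact B\<close> that
    by (intro cSup_upper bounded_imp_bdd_above compact_imp_bounded)
  have s: "a \<le> s" "s \<le> t" "s \<in> {a..b}" "\<forall>j\<in>I. g j s \<le> c"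
    using sB t by (auto simp: B_def)
  have "s \<noteq> t"
    using above i s(4) by auto
  then have "s < t"
    using s(2) by simp
  have step: "\<forall>\<^sub>F r in at s within {s<..t}. g j r \<le> c" if j: "j \<in> I" for j
  proof (cases "g j s = c")
    case True
    then have "g' j s < 0"
      using active[OF j s(3)] s(4) by blast
    from has_real_derivative_neg_dec_right[OF der[OF j s(3)] this]
    obtain d where d: "d > 0" "\<And>h. 0 < h \<Longrightarrow> s + h \<in> {a..b} \<Longrightarrow> h < d \<Longrightarrow> g j (s + h) < g j s"
      by blast
    show ?thesis
      unfolding eventually_at
    proof (intro exI conjI ballI impI)
      show "d > 0" by fact
      fix r assume r: "r \<in> {s<..t}" "r \<noteq> s \<and> dist r s < d"
      then show "g j r \<le> c"
        using d(2)[of "r - s"] True s t by (auto simp: dist_real_def)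
    qed
  next
    case False
    then have "g j s < c"
      using s(4) j by force
    have "(g j \<longlongrightarrow> g j s) (at s within {a..b})"
      using cont[OF j] s(3) by (simp add: continuous_on)
    then have "(g j \<longlongrightarrow> g j s) (at s within {s<..t})"
      by (rule tendsto_within_subset) (use s t in auto)
    from order_tendstoD(2)[OF this \<open>g j s < c\<close>] show ?thesis
      by eventually_elim simp
  qed
  have "\<forall>\<^sub>F r in at s within {s<..t}. \<forall>j\<in>I. g j r \<le> c"
    using fin step by (simp add: eventually_ball_finite)
  moreover have "\<forall>\<^sub>F r in at s within {s<..t}. r \<in> {s<..t}"
    by (simp add: eventually_at_filter)
  ultimately have "\<forall>\<^sub>F r in at s within {s<..t}. r \<in> B \<and> s < r"
    by eventually_elim (use s t in \<open>auto simp: B_def\<close>)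
  then have "\<forall>\<^sub>F r in at s within {s<..t}. False"
    by eventually_elim (use upper in force)
  moreover have "at s within {s<..t} \<noteq> bot"
    using \<open>s < t\<close> by (simp add: trivial_limit_within islimpt_greaterThanLessThan1 islimpt_Ioc)
  ultimately show False
    by simp
qed

text \<open>
  The Picard operator becomes a contraction on all of \<open>{0..}\<close> at once when functions are measured with
  the weight \<open>exp (- k * t)\<close> for \<open>k\<close> above \<open>2 * L\<close>. Storing the weighted function
  \<open>z t = exp (- k * t) *\<^sub>R x t\<close> makes the weighted norm the supremum norm of bounded continuous
  functions, a complete space.
\<close>

lemma Lipschitz_global_solution:
  fixes F :: "'a::euclidean_space \<Rightarrow> 'a"
  assumes lip: "L-lipschitz_on UNIV F" and bdd: "\<And>q. norm (F q) \<le> B"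
  shows "\<exists>x. solves_ode_on F {0..} x \<and> x 0 = p"
proof -
  define k where "k = 2 * L + 1"
  have L: "0 \<le> L" using lip by (rule lipschitz_on_nonneg)
  then have k: "k > 0" "L \<le> k / 2" by (auto simp: k_def)
  have B: "0 \<le> B" using bdd[of p] norm_ge_zero order_trans by blast
  have contF: "continuous_on UNIV F"
    using lip by (rule lipschitz_on_continuous_on)
  define H where "H z r = F (exp (k * r) *\<^sub>R apply_bcontfun z r)" for z :: "real \<Rightarrow>\<^sub>C 'a" and r
  have contH: "continuous_on S (H z)" for S z
    unfolding H_def
    by (rule continuous_on_compose2[OF contF]) (auto intro!: continuous_intros)
  have intH: "H z integrable_on {0..t}" for z t
    by (intro integrable_continuous_real contH)
  define P where "P z t = p + integral {0..t} (H z)" for z t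
  have P_der: "(P z has_vector_derivative H z t) (at t within {0..})" if "t \<ge> 0" for z and t :: real
  proof -
    have "((\<lambda>u. integral {0..u} (H z)) has_vector_derivative H z t) (at t within {0..t+1})"
      by (rule integral_has_vector_derivative) (use contH that in auto)
    then have "(P z has_vector_derivative H z t) (at t within {0..t+1})"
      unfolding P_def by (auto intro!: derivative_eq_intros)
    also have "at t within {0..t+1} = at t within {0..}"
      by (rule at_within_nhd[of _ "{..<t+1}"]) auto
    finally show ?thesis .
  qed
  have P_cont: "continuous_on {0..} (P z)" for z
    using P_der by (intro continuous_on_vector_derivative) auto
  have P_bound: "norm (P z t) \<le> norm p + t * B" if "t \<ge> 0" for z and t :: real
  proof -
    have "norm (integral {0..t} (H z)) \<le> B * (t - 0)"
      using that contH bdd by (intro integral_bound) (auto simp: H_def)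
    then show ?thesis
      unfolding P_def by (intro norm_triangle_le) (auto simp: mult.commute)
  qed
  \<comment> \<open>Elements of the function space are defined on the whole line; the operator extends its values
      from \<open>{0..}\<close> by the constant value at 0.\<close>
  define Q where "Q z t = exp (- k * max 0 t) *\<^sub>R P z (max 0 t)" for z t
  have Q_bcontfun: "Q z \<in> bcontfun" for z
  proof (rule bcontfun_normI)
    show "continuous_on UNIV (Q z)"
      unfolding Q_def
      by (intro continuous_intros continuous_on_compose2[OF P_cont[of z]]) auto
    fix t :: real
    define u where "u = max 0 t"
    have u: "u \<ge> 0" by (simp add: u_def)
    have "k * u \<le> exp (k * u)"
      using exp_ge_add_one_self[of "k * u"] by linarith
    then have "u * exp (- k * u) \<le> 1 / k"
      using k by (simp add: exp_minus field_simps)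
    then have "B * (u * exp (- k * u)) \<le> B * (1 / k)"
      using B by (rule mult_left_mono)
    moreover have "exp (- k * u) * norm p \<le> norm p"
      using k u by (intro mult_left_le_one_le) auto
    moreover have "norm (Q z t) \<le> exp (- k * u) * (norm p + u * B)"
      using P_bound[OF u] unfolding Q_def u_def by (auto intro: mult_left_mono)
    ultimately show "norm (Q z t) \<le> norm p + B * (1 / k)"
      by (simp add: algebra_simps)
  qed
  have Q_contract: "dist (Q y t) (Q z t) \<le> 1/2 * dist y z" for y z and t :: real
  proof -
    define u where "u = max 0 t"
    define D where "D = dist y z"
    have u: "u \<ge> 0" by (simp add: u_def)
    have "((\<lambda>r. exp (k * r)) has_integral exp (k * u) / k - exp (k * 0) / k) {0..u}"
      using u k by (intro fundamental_theorem_of_calculus)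
        (auto intro!: derivative_eq_intros simp flip: has_real_derivative_iff_has_vector_derivative)
    then have expint: "((\<lambda>r. L * D * exp (k * r)) has_integral L * D * (exp (k * u) / k - 1 / k)) {0..u}"
      by (auto dest: has_integral_mult_right)
    have "norm (integral {0..u} (\<lambda>r. H y r - H z r)) \<le> L * D * (exp (k * u) / k - 1 / k)"
    proof (rule integral_norm_bound_integral[THEN order_trans])
      show "(\<lambda>r. H y r - H z r) integrable_on {0..u}"
        by (intro integrable_diff intH)
      show "(\<lambda>r. L * D * exp (k * r)) integrable_on {0..u}"
        using expint by blast
      show "norm (H y r - H z r) \<le> L * D * exp (k * r)" for r
      proof -
        have "norm (H y r - H z r) \<le> L * dist (exp (k * r) *\<^sub>R apply_bcontfun y r) (exp (k * r) *\<^sub>R apply_bcontfun z r)"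
          unfolding H_def dist_norm[symmetric] using lip by (rule lipschitz_onD) auto
        also have "\<dots> = L * (exp (k * r) * dist (apply_bcontfun y r) (apply_bcontfun z r))"
          by (simp add: dist_norm flip: scaleR_diff_right)
        also have "\<dots> \<le> L * (exp (k * r) * D)"
          using L unfolding D_def by (intro mult_left_mono dist_bounded) auto
        finally show ?thesis by (simp add: mult_ac)
      qed
      show "integral {0..u} (\<lambda>r. L * D * exp (k * r)) \<le> L * D * (exp (k * u) / k - 1 / k)"
        by (subst integral_unique[OF expint]) (rule order_refl)
    qed
    also have "\<dots> \<le> L * D * (exp (k * u) / k)"
      using L k by (intro mult_left_mono) (auto simp: D_def)
    also have "\<dots> \<le> k / 2 * D * (exp (k * u) / k)"
      using k by (intro mult_right_mono) (auto simp: D_def)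
    also have "\<dots> = D / 2 * exp (k * u)"
      using k by simp
    finally have *: "norm (P y u - P z u) \<le> D / 2 * exp (k * u)"
      by (simp add: P_def integral_diff intH)
    have "dist (Q y t) (Q z t) = exp (- k * u) * norm (P y u - P z u)"
      by (simp add: Q_def u_def dist_norm flip: scaleR_diff_right)
    also have "\<dots> \<le> exp (- k * u) * (D / 2 * exp (k * u))"
      using * by (intro mult_left_mono) auto
    also have "\<dots> = 1/2 * D"
      by (simp add: exp_minus)
    finally show ?thesis by (simp add: D_def)
  qed
  have "dist (Bcontfun (Q y)) (Bcontfun (Q z)) \<le> 1/2 * dist y z" for y z
    using Q_contract by (intro dist_bound) (simp add: Bcontfun_inverse Q_bcontfun)
  then have "\<exists>!z. Bcontfun (Q z) = z"
    by (intro banach_fix_type[of "1/2"]) auto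
  then obtain z where "Bcontfun (Q z) = z" by blast
  then have fixpoint: "apply_bcontfun z t = Q z t" for t
    by (metis Bcontfun_inverse Q_bcontfun)
  have "H z t = F (P z t)" if "t \<ge> 0" for t
    using that by (simp add: H_def fixpoint Q_def exp_minus)
  then have "solves_ode_on F {0..} (P z)"
    using P_der[of _ z] by (auto simp: solves_ode_on_def)
  moreover have "P z 0 = p"
    by (simp add: P_def)
  ultimately show ?thesis by blast
qed

section \<open>Polygons crossed by the flow\<close>

text \<open>
  For varying \<open>c\<close> these are the sublevel sets of the maximum over \<open>n \<in> N\<close> of \<open>n \<bullet> p\<close>.
\<close>

definition polygon :: "'a::real_inner set \<Rightarrow> real \<Rightarrow> 'a set"
  where "polygon N c = {p. \<forall>n\<in>N. n \<bullet> p \<le> c}"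

text \<open>
  The maximum over \<open>n \<in> N\<close> of \<open>n \<bullet> p\<close> is a proper function that decreases strictly along
  the flow wherever it is at least \<open>R\<close>. At corners of a polygon this concerns each of the adjacent
  sides.
\<close>

definition crosses_inward :: "('a::real_inner \<Rightarrow> 'a) \<Rightarrow> 'a set \<Rightarrow> real \<Rightarrow> bool"
  where "crosses_inward f N R \<longleftrightarrow>
    finite N \<and> (\<forall>c. bounded (polygon N c)) \<and>
    (\<forall>c\<ge>R. \<forall>p\<in>polygon N c. \<forall>n\<in>N. n \<bullet> p = c \<longrightarrow> n \<bullet> f p < 0)"

lemma mem_polygon: "p \<in> polygon N c \<longleftrightarrow> (\<forall>n\<in>N. n \<bullet> p \<le> c)"
  by (simp add: polygon_def)

lemma closed_polygon: "closed (polygon N c)"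
proof -
  have "polygon N c = (\<Inter>n\<in>N. {p. n \<bullet> p \<le> c})"
    by (auto simp: polygon_def)
  then show ?thesis
    by (simp add: closed_INT closed_halfspace_le)
qed

lemma convex_polygon: "convex (polygon N c)"
proof -
  have "polygon N c = (\<Inter>n\<in>N. {p. n \<bullet> p \<le> c})"
    by (auto simp: polygon_def)
  then show ?thesis
    by (simp add: convex_INT convex_halfspace_le)
qed

lemma bounded_subset_polygon:
  fixes S :: "'a::real_inner set"
  assumes "finite N" "bounded S"
  shows "\<exists>c\<ge>R. S \<subseteq> polygon N c"
proof -
  obtain B where B: "\<And>p. p \<in> S \<Longrightarrow> norm p \<le> B" "B > 0"
    using assms(2) bounded_pos by metis
  define c where "c = max R (Max (insert 0 (norm ` N)) * B)"
  have "n \<bullet> p \<le> c" if "p \<in> S" "n \<in> N" for n p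
  proof -
    have "n \<bullet> p \<le> norm n * norm p" by (rule norm_cauchy_schwarz)
    also have "\<dots> \<le> Max (insert 0 (norm ` N)) * B"
      using assms(1) that B by (intro mult_mono Max_ge) (auto simp: Max_ge_iff)
    finally show ?thesis by (simp add: c_def)
  qed
  then show ?thesis
    by (intro exI[of _ c]) (auto simp: mem_polygon c_def)
qed

lemma solves_ode_on_subset:
  assumes "solves_ode_on f I x" "J \<subseteq> I"
  shows "solves_ode_on f J x"
  using assms has_vector_derivative_within_subset unfolding solves_ode_on_def by blast

lemma inner_has_real_derivative:
  assumes "(x has_vector_derivative v) (at t within S)"
  shows "((\<lambda>s. n \<bullet> x s) has_real_derivative n \<bullet> v) (at t within S)"
  unfolding has_real_derivative_iff_has_vector_derivative
  using assms by (rule bounded_linear.has_vector_derivative[OF bounded_linear_inner_right])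

lemma polygon_invariant:
  fixes x :: "real \<Rightarrow> 'a::real_inner"
  assumes N: "finite N"
    and inward: "\<And>p n. p \<in> polygon N c \<Longrightarrow> n \<in> N \<Longrightarrow> n \<bullet> p = c \<Longrightarrow> n \<bullet> f p < 0"
    and x: "solves_ode_on f {a..b} x" "x a \<in> polygon N c" and t: "t \<in> {a..b}"
  shows "x t \<in> polygon N c"
  unfolding mem_polygon
proof
  fix n assume n: "n \<in> N"
  show "n \<bullet> x t \<le> c"
  proof (rule family_stays_below[where g = "\<lambda>n t. n \<bullet> x t" and g' = "\<lambda>n t. n \<bullet> f (x t)", OF N _ _ _ n t])
    show "((\<lambda>t. m \<bullet> x t) has_real_derivative m \<bullet> f (x s)) (at s within {a..b})"
      if "s \<in> {a..b}" for m s
      using x(1) that by (intro inner_has_real_derivative) (simp add: solves_ode_on_def)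
  qed (use x(2) inward in \<open>auto simp: mem_polygon\<close>)
qed

text \<open>
  For each \<open>n\<close>, the part of the compact polygon on which \<open>n\<close> is the active functional at a level of at
  least \<open>R\<close> is compact, so the negative function \<open>n \<bullet> f p\<close> has a negative maximum there.
\<close>

lemma uniform_inward_speed:
  fixes f :: "'a::euclidean_space \<Rightarrow> 'a"
  assumes cross: "crosses_inward f N R" and cont: "continuous_on (polygon N C) f"
  shows "\<exists>e>0. \<forall>p\<in>polygon N C. \<forall>n\<in>N. R \<le> n \<bullet> p \<and> (\<forall>m\<in>N. m \<bullet> p \<le> n \<bullet> p) \<longrightarrow> n \<bullet> f p \<le> - e"
proof -
  have fin: "finite N"
    using cross by (simp add: crosses_inward_def)
  have "\<exists>e>0. \<forall>p\<in>polygon N C. R \<le> n \<bullet> p \<and> (\<forall>m\<in>N. m \<bullet> p \<le> n \<bullet> p) \<longrightarrow> n \<bullet> f p \<le> - e"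
    if n: "n \<in> N" for n
  proof -
    define S where "S = polygon N C \<inter> ({p. R \<le> n \<bullet> p} \<inter> (\<Inter>m\<in>N. {p. m \<bullet> p \<le> n \<bullet> p}))"
    have "compact S"
      unfolding S_def using cross
      by (intro compact_Int_closed closed_Int closed_INT ballI closed_Collect_le continuous_intros)
        (auto simp: crosses_inward_def compact_eq_bounded_closed closed_polygon)
    show ?thesis
    proof (cases "S = {}")
      case True
      then show ?thesis by (intro exI[of _ 1]) (auto simp: S_def)
    next
      case False
      have "continuous_on S (\<lambda>p. n \<bullet> f p)"
        using cont by (intro continuous_intros) (auto simp: S_def elim: continuous_on_subset)
      from continuous_attains_sup[OF \<open>compact S\<close> False this]
      obtain q where q: "q \<in> S" "\<And>p. p \<in> S \<Longrightarrow> n \<bullet> f p \<le> n \<bullet> f q" by blast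
      have "n \<bullet> f q < 0"
        using cross n q(1) by (auto simp: crosses_inward_def S_def mem_polygon)
      then show ?thesis
        using q(2) by (intro exI[of _ "- (n \<bullet> f q)"]) (auto simp: S_def)
    qed
  qed
  then obtain e where e: "\<And>n. n \<in> N \<Longrightarrow> e n > 0"
    "\<And>n p. n \<in> N \<Longrightarrow> p \<in> polygon N C \<Longrightarrow> R \<le> n \<bullet> p \<and> (\<forall>m\<in>N. m \<bullet> p \<le> n \<bullet> p) \<Longrightarrow> n \<bullet> f p \<le> - e n"
    by metis
  define d where "d = Min (insert 1 (e ` N))"
  have "d > 0" "\<And>n. n \<in> N \<Longrightarrow> d \<le> e n"
    using fin e(1) by (auto simp: d_def)
  then show ?thesis
    using e(2) by (intro exI[of _ d]) fastforce
qed

text \<open>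
  While the orbit is outside the polygon of level \<open>R\<close>, the functions \<open>n \<bullet> x t + e / 2 * t\<close> satisfy
  the hypotheses of the comparison lemma, which bounds the level by \<open>C - e / 2 * t\<close>. This is
  absurd at time \<open>T\<close>, where the bound reaches \<open>R\<close>.
\<close>

lemma enters_polygon:
  fixes f :: "'a::euclidean_space \<Rightarrow> 'a"
  assumes cross: "crosses_inward f N R" and cont: "continuous_on (polygon N C) f"
    and C: "R \<le> C" and x: "solves_ode_on f {0..} x" "x 0 \<in> polygon N C"
  shows "\<exists>t\<ge>0. x t \<in> polygon N R"
proof (rule ccontr)
  assume "\<not> ?thesis"
  then have outside: "\<exists>n\<in>N. R < n \<bullet> x t" if "t \<ge> 0" for t
    using that by (meson mem_polygon not_le)
  have fin: "finite N"
    using cross by (simp add: crosses_inward_def)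
  obtain e where e: "e > 0" "\<And>p n. p \<in> polygon N C \<Longrightarrow> n \<in> N \<Longrightarrow> R \<le> n \<bullet> p \<Longrightarrow> \<forall>m\<in>N. m \<bullet> p \<le> n \<bullet> p
      \<Longrightarrow> n \<bullet> f p \<le> - e"
    using uniform_inward_speed[OF cross cont] by blast
  define T where "T = 2 * (C - R) / e"
  have T: "T \<ge> 0" using C e by (simp add: T_def)
  have xT: "solves_ode_on f {0..T} x"
    using x(1) by (rule solves_ode_on_subset) auto
  have stays: "x t \<in> polygon N C" if "t \<in> {0..T}" for t
    using cross C by (intro polygon_invariant[OF fin _ xT x(2) that]) (auto simp: crosses_inward_def)
  have final: "n \<bullet> x T + e / 2 * T \<le> C" if n: "n \<in> N" for n
  proof (rule family_stays_below[where I = N and a = 0 and b = T and g = "\<lambda>n t. n \<bullet> x t + e / 2 * t"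
        and g' = "\<lambda>n t. n \<bullet> f (x t) + e / 2", OF fin _ _ _ n])
    show "((\<lambda>t. m \<bullet> x t + e / 2 * t) has_real_derivative m \<bullet> f (x t) + e / 2) (at t within {0..T})"
      if "t \<in> {0..T}" for m t
      using xT that by (auto intro!: derivative_eq_intros inner_has_real_derivative simp: solves_ode_on_def)
    show "m \<bullet> x 0 + e / 2 * 0 \<le> C" if "m \<in> N" for m
      using x(2) that by (simp add: mem_polygon)
    show "m \<bullet> f (x t) + e / 2 < 0"
      if m: "m \<in> N" and t: "t \<in> {0..T}" and act: "m \<bullet> x t + e / 2 * t = C"
        "\<forall>j\<in>N. j \<bullet> x t + e / 2 * t \<le> C" for m t
    proof -
      have top: "\<forall>j\<in>N. j \<bullet> x t \<le> m \<bullet> x t"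
        using act by force
      then have "R \<le> m \<bullet> x t"
        using outside[of t] t by fastforce
      from e(2)[OF stays[OF t] m this top] e(1) show ?thesis by simp
    qed
    show "T \<in> {0..T}" using T by simp
  qed
  have "e / 2 * T = C - R"
    using e(1) by (simp add: T_def)
  then have "n \<bullet> x T \<le> R" if "n \<in> N" for n
    using final[OF that] by linarith
  then show False
    using outside[OF T] by force
qed

text \<open>
  The field is replaced outside the polygon by its value at the closest point, which makes it bounded
  and globally Lipschitz. The global solution of the new field stays in the polygon, where nothing has
  been changed.
\<close>

lemma solution_exists_in_polygon:
  fixes f :: "'a::euclidean_space \<Rightarrow> 'a"
  assumes cross: "crosses_inward f N R" and lip: "L-lipschitz_on (polygon N C) f"
    and C: "R \<le> C" and p: "p \<in> polygon N C"
  shows "\<exists>x. solves_ode_on f {0..} x \<and> x 0 = p"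
proof -
  let ?K = "polygon N C"
  have fin: "finite N" and comp: "compact ?K"
    using cross by (auto simp: crosses_inward_def compact_eq_bounded_closed closed_polygon)
  define F where "F = (\<lambda>q. f (closest_point ?K q))"
  have K: "closest_point ?K q \<in> ?K" for q
    using p by (intro closest_point_in_set closed_polygon) auto
  have Ff: "F q = f q" if "q \<in> ?K" for q
    using that by (simp add: F_def closest_point_self)
  have "L-lipschitz_on UNIV F"
  proof (rule lipschitz_onI)
    show "0 \<le> L" using lip by (rule lipschitz_on_nonneg)
    fix q r
    have "dist (F q) (F r) \<le> L * dist (closest_point ?K q) (closest_point ?K r)"
      unfolding F_def using lip K K by (rule lipschitz_onD)
    also have "\<dots> \<le> L * dist q r"
      using p \<open>0 \<le> L\<close> by (intro mult_left_mono closest_point_lipschitz closed_polygon convex_polygon) auto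
    finally show "dist (F q) (F r) \<le> L * dist q r" .
  qed
  moreover obtain B where "\<And>q. norm (F q) \<le> B"
  proof -
    have "bounded (f ` ?K)"
      using comp lip by (intro compact_imp_bounded compact_continuous_image lipschitz_on_continuous_on)
    then show ?thesis
      using that K unfolding F_def bounded_iff by blast
  qed
  ultimately obtain x where x: "solves_ode_on F {0..} x" "x 0 = p"
    using Lipschitz_global_solution by blast
  have "x t \<in> ?K" if "t \<ge> 0" for t
  proof (rule polygon_invariant[OF fin, where f = F and a = 0 and b = t])
    show "solves_ode_on F {0..t} x"
      using x(1) by (rule solves_ode_on_subset) auto
    show "n \<bullet> F q < 0" if "q \<in> ?K" "n \<in> N" "n \<bullet> q = C" for q n
      using cross C that Ff by (auto simp: crosses_inward_def)
  qed (use x p that in auto)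
  then have "solves_ode_on f {0..} x"
    using x(1) Ff by (simp add: solves_ode_on_def)
  then show ?thesis
    using x(2) by blast
qed

theorem permanent_if_crosses_inward:
  fixes f :: "'a::euclidean_space \<Rightarrow> 'a"
  assumes cross: "crosses_inward f N R" and R: "R \<ge> 0"
    and lip: "\<And>K. compact K \<Longrightarrow> \<exists>L. L-lipschitz_on K f"
  shows "permanent f"
  unfolding permanent_def
proof (intro exI conjI allI)
  let ?K = "polygon N R"
  have fin: "finite N" and comp: "compact (polygon N c)" for c
    using cross by (auto simp: crosses_inward_def compact_eq_bounded_closed closed_polygon)
  show "compact ?K" by (rule comp)
  show "?K \<noteq> {}" using R mem_polygon[of 0 N R] by auto
  have inv: "x t \<in> ?K" if "solves_ode_on f {a..b} x" "x a \<in> ?K" "t \<in> {a..b}" for x a b t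
    using cross that by (intro polygon_invariant[OF fin _ that]) (auto simp: crosses_inward_def)
  show "forward_invariant f ?K"
    using inv by (auto simp: forward_invariant_def)
  fix p
  obtain C where C: "R \<le> C" "p \<in> polygon N C"
    using bounded_subset_polygon[OF fin, of "{p}" R] by auto
  obtain L where L: "L-lipschitz_on (polygon N C) f"
    using lip comp by blast
  show "attracts_point f ?K p"
    unfolding attracts_point_def
  proof (intro conjI allI impI)
    show "\<exists>x. solves_ode_on f {0..} x \<and> x 0 = p"
      by (rule solution_exists_in_polygon[OF cross L C])
    fix x assume x: "solves_ode_on f {0..} x \<and> x 0 = p"
    obtain s where s: "s \<ge> 0" "x s \<in> ?K"
      using enters_polygon[OF cross lipschitz_on_continuous_on[OF L] C(1)] x C(2) by blast
    have "x t \<in> ?K" if "t \<ge> s" for t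
    proof (rule inv[where a = s and b = t])
      show "solves_ode_on f {s..t} x"
        by (rule solves_ode_on_subset[of _ "{0..}"]) (use x s in auto)
    qed (use s that in auto)
    then have "\<forall>\<^sub>F t in at_top. infdist (x t) ?K = 0"
      by (auto simp: eventually_at_top_linorder intro!: exI[of _ s])
    then show "((\<lambda>t. infdist (x t) ?K) \<longlongrightarrow> 0) at_top"
      by (rule tendsto_eventually)
  qed
qed

lemma solves_ode_on_reverse:
  fixes x :: "real \<Rightarrow> 'a::real_normed_vector"
  assumes "solves_ode_on f {0..t} x"
  shows "solves_ode_on (\<lambda>p. - f p) {0..t} (\<lambda>s. x (t - s))"
  unfolding solves_ode_on_def
proof
  fix s assume s: "s \<in> {0..t}"
  have img: "(\<lambda>s. t - s) ` {0..t} = {0..t}"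
    by (auto intro: image_eqI[of _ _ "t - _"])
  have "(x has_vector_derivative f (x (t - s))) (at (t - s) within (\<lambda>s. t - s) ` {0..t})"
    using assms s unfolding img by (auto simp: solves_ode_on_def)
  moreover have "((\<lambda>s. t - s) has_vector_derivative - 1) (at s within {0..t})"
    by (auto intro!: derivative_eq_intros)
  ultimately have "((x \<circ> (\<lambda>s. t - s)) has_vector_derivative - 1 *\<^sub>R f (x (t - s))) (at s within {0..t})"
    by (intro vector_diff_chain_within)
  then show "((\<lambda>s. x (t - s)) has_vector_derivative - f (x (t - s))) (at s within {0..t})"
    by (simp add: o_def)
qed

text \<open>
  An orbit that starts outside a large polygon and is later inside, as attraction by a compact set would
  require, becomes in reversed time an orbit that leaves this polygon.
\<close>

theorem not_permanent_if_crosses_outward: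
  fixes f :: "'a::euclidean_space \<Rightarrow> 'a"
  assumes cross: "crosses_inward (\<lambda>p. - f p) N R"
  shows "\<not> permanent f"
proof
  assume "permanent f"
  then obtain K where K: "compact K" "K \<noteq> {}" "\<And>p. attracts_point f K p"
    by (auto simp: permanent_def)
  have fin: "finite N" and bdd: "bounded (polygon N c)" for c
    using cross by (auto simp: crosses_inward_def)
  have "bounded {q. infdist q K \<le> 1}"
    using compact_infdist_le[OF K(2,1), of 1] by (simp add: compact_imp_bounded)
  then obtain c where c: "R \<le> c" "{q. infdist q K \<le> 1} \<subseteq> polygon N c"
    using bounded_subset_polygon[OF fin] by blast
  obtain p where p: "p \<notin> polygon N c"
    using bdd[of c] not_bounded_UNIV[where 'a = 'a] by (metis UNIV_eq_I)
  obtain x where x: "solves_ode_on f {0..} x" "x 0 = p" "((\<lambda>t. infdist (x t) K) \<longlongrightarrow> 0) at_top"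
    using K(3)[of p] by (auto simp: attracts_point_def)
  have "\<forall>\<^sub>F t in at_top. infdist (x t) K < 1 \<and> (0::real) \<le> t"
    using order_tendstoD(2)[OF x(3)] eventually_ge_at_top by (simp add: eventually_conj)
  then obtain t where t: "0 \<le> t" "infdist (x t) K < 1"
    using eventually_happens'[OF trivial_limit_at_top_linorder] by blast
  have "solves_ode_on f {0..t} x"
    using x(1) by (rule solves_ode_on_subset) auto
  then have "solves_ode_on (\<lambda>p. - f p) {0..t} (\<lambda>s. x (t - s))"
    by (rule solves_ode_on_reverse)
  then have "x (t - t) \<in> polygon N c"
    by (rule polygon_invariant[OF fin, rotated, where t = t and c = c])
      (use cross c t in \<open>auto simp: crosses_inward_def\<close>)
  then show False
    using p x(2) by simp
qed

text \<open>
  A self-adjoint involution such as a reflection moves onto the other factor of an inner product, so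
  that for the normal \<open>r n\<close> the level and its derivative at \<open>p\<close> are those of the field \<open>g\<close> for \<open>n\<close> at
  \<open>r p\<close>.
\<close>

lemma crosses_inward_conjugate:
  fixes f :: "'a::euclidean_space \<Rightarrow> 'a"
  assumes cross: "crosses_inward g N R" and r: "linear r" "\<And>p q. r p \<bullet> q = p \<bullet> r q"
    and inv: "\<And>p. r (r p) = p" and conj: "\<And>p. f p = r (g (r p))"
  shows "crosses_inward f (r ` N) R"
proof -
  have mem: "p \<in> polygon (r ` N) c \<longleftrightarrow> r p \<in> polygon N c" for p c
    by (simp add: mem_polygon r(2))
  have "polygon (r ` N) c \<subseteq> r ` polygon N c" for c
    using mem inv by (metis image_eqI subsetI)
  moreover have "bounded (r ` polygon N c)" for c
    using cross r(1) by (intro bounded_linear_image) (auto simp: crosses_inward_def linear_conv_bounded_linear)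
  ultimately have "bounded (polygon (r ` N) c)" for c
    by (meson bounded_subset)
  then show ?thesis
    using cross unfolding crosses_inward_def by (auto simp: mem r(2) conj inv)
qed

section \<open>The tilted box\<close>

text \<open>
  On the right side of the box the terms of index 1 and 4 push outwards, those of index 2 and 3 inwards
  once the side is tilted. Term 3 beats term 1 already at the lower corner \<open>(U, - Z)\<close> and therefore above
  and to the right of it. Term 4 is beaten by term 2 where \<open>v\<close> is nonnegative, and by term 3 where \<open>v\<close> is negative, because
  there it is below term 1. The other three sides are instances of this lemma for the system in
  coordinates rotated by multiples of a right angle.
\<close>

lemma side_dominance:
  fixes a1 a2 a3 a4 b1 b2 b3 b4 :: real
  assumes a: "a4 \<le> a1" "a1 \<le> a3" "a4 \<le> a2" and b: "b1 \<le> b3" "b1 \<le> b4" "b4 \<le> b2"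
    and k: "k \<le> (a3 - a1) * U - (b3 - b1) * Z" "k \<le> (a2 - a4) * U" "0 \<le> U"
    and r: "0 \<le> r" and uv: "r * U \<le> u" "- (r * Z) \<le> v"
  shows "max (a1 * u + b1 * v) (a4 * u + b4 * v) + k * r
      \<le> max (a2 * u + b2 * v) (a3 * u + b3 * v)"
proof -
  have u: "0 \<le> u"
    using k r uv by (meson mult_nonneg_nonneg order_trans)
  have "k * r \<le> ((a3 - a1) * U - (b3 - b1) * Z) * r"
    using k(1) r by (rule mult_right_mono)
  also have "\<dots> = (a3 - a1) * (r * U) + (b3 - b1) * (- (r * Z))"
    by (simp add: algebra_simps)
  also have "\<dots> \<le> (a3 - a1) * u + (b3 - b1) * v"
    using a b uv by (intro add_mono mult_left_mono) auto
  finally have d31: "k * r \<le> (a3 - a1) * u + (b3 - b1) * v" .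
  have d4: "k * r \<le> (a2 - a4) * u + (b2 - b4) * v \<or> k * r \<le> (a3 - a4) * u + (b3 - b4) * v"
  proof (cases "0 \<le> v")
    case True
    have "k * r \<le> (a2 - a4) * U * r"
      using k(2) r by (rule mult_right_mono)
    also have "\<dots> = (a2 - a4) * (r * U)"
      by (simp add: mult_ac)
    also have "\<dots> \<le> (a2 - a4) * u"
      using a uv by (intro mult_left_mono) auto
    also have "\<dots> \<le> (a2 - a4) * u + (b2 - b4) * v"
      using b True by simp
    finally show ?thesis by blast
  next
    case False
    have "(a3 - a1) * u \<le> (a3 - a4) * u" "(b3 - b1) * v \<le> (b3 - b4) * v"
      using a b u False by (auto intro: mult_right_mono mult_right_mono_neg)
    then show ?thesis
      using d31 by linarith
  qed
  have "a1 * u + b1 * v + k * r \<le> a3 * u + b3 * v"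
    using d31 by (simp add: left_diff_distrib)
  moreover have "a4 * u + b4 * v + k * r \<le> a2 * u + b2 * v \<or> a4 * u + b4 * v + k * r \<le> a3 * u + b3 * v"
    using d4 by (auto simp: left_diff_distrib)
  ultimately show ?thesis
    by (auto simp: max_add_distrib_left le_max_iff_disj)
qed

lemma exp_combination_neg:
  fixes E1 E2 E3 E4 d \<eta> :: real
  assumes dom: "max E1 E4 + d \<le> max E2 E3" and \<eta>: "0 < \<eta>" "\<eta> \<le> 1" and d: "2 < \<eta> * exp d"
  shows "exp E1 - exp E2 - \<eta> * (exp E3 - exp E4) < 0"
proof -
  define m where "m = max E1 E4"
  have "exp E1 \<le> exp m" "\<eta> * exp E4 \<le> 1 * exp m"
    using \<eta> by (simp add: m_def, intro mult_mono) (auto simp: m_def)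
  then have "exp E1 + \<eta> * exp E4 \<le> 2 * exp m"
    by linarith
  also have "\<dots> < \<eta> * exp d * exp m"
    using d by simp
  also have "\<dots> = \<eta> * exp (m + d)"
    by (simp add: exp_add)
  also have "\<dots> \<le> \<eta> * exp (max E2 E3)"
    using dom \<eta> by (simp add: m_def)
  also have "\<dots> \<le> exp E2 + \<eta> * exp E3"
  proof (cases "E2 \<le> E3")
    case False
    have "\<eta> * exp E2 \<le> exp E2" "0 \<le> \<eta> * exp E3"
      using \<eta> by auto
    moreover have "max E2 E3 = E2"
      using False by simp
    ultimately show ?thesis
      by (metis add_increasing2)
  qed (simp add: max_def)
  finally show ?thesis
    by (simp add: algebra_simps)
qed

text \<open>
  The expression that is shown to be negative is the component of the field along the normal
  \<open>(1, - \<eta>)\<close> at a point of the tilted right side of the box enlarged by the factor \<open>r\<close>. The number \<open>k\<close> is the width of a neighbourhood of the straight side on which the comparison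
  of exponents keeps a margin \<open>k\<close>; the bound on \<open>\<eta>\<close> keeps the tilted side in that neighbourhood.
\<close>

lemma tilted_side_inward:
  fixes a1 a2 a3 a4 b1 b2 b3 b4 :: real
  assumes a: "a4 \<le> a1" "a1 \<le> a3" "a4 \<le> a2" and b: "b1 \<le> b3" "b1 \<le> b4" "b4 \<le> b2"
    and k: "k \<le> (a3 - a1) * (U - k) - (b3 - b1) * (Z + k)" "k \<le> (a2 - a4) * (U - k)" "k \<le> U" "0 \<le> k"
    and Z: "0 \<le> Z" and \<eta>: "0 < \<eta>" "\<eta> \<le> 1" "\<eta> * (U + Z) \<le> k"
    and r: "0 \<le> r" "2 < \<eta> * exp (k * r)"
    and uv: "u - \<eta> * v = r * U" "- (r * Z) \<le> \<eta> * u + v"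
  shows "(exp (a1 * u + b1 * v) - exp (a2 * u + b2 * v))
      - \<eta> * (exp (a3 * u + b3 * v) - exp (a4 * u + b4 * v)) < 0"
proof (rule exp_combination_neg[OF _ \<eta>(1,2) r(2)])
  have U: "0 \<le> U"
    using k(3,4) by simp
  have v: "- (r * (Z + \<eta> * U)) \<le> v"
  proof (cases "0 \<le> v")
    case True
    moreover have "0 \<le> r * (Z + \<eta> * U)"
      using r Z \<eta> U by simp
    ultimately show ?thesis by linarith
  next
    case False
    have "\<eta> * u = \<eta> * (r * U) + \<eta> * \<eta> * v"
      using uv(1) by (simp add: algebra_simps flip: distrib_left)
    then have "- (r * Z) - \<eta> * (r * U) \<le> v + \<eta> * \<eta> * v"
      using uv(2) by simp
    also have "\<dots> \<le> v"
      using False \<eta> by (simp add: mult_nonneg_nonpos)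
    finally show ?thesis by (simp add: algebra_simps)
  qed
  have "r * (U - k) \<le> u"
  proof -
    have "\<eta> * (\<eta> * U) \<le> \<eta> * U"
      using \<eta> U by (intro mult_left_mono) (auto intro: mult_left_le_one_le)
    then have "\<eta> * (Z + \<eta> * U) \<le> k"
      using \<eta>(3) by (simp add: algebra_simps)
    then have "r * (\<eta> * (Z + \<eta> * U)) \<le> r * k"
      using r by (intro mult_left_mono) auto
    moreover have "\<eta> * (- (r * (Z + \<eta> * U))) \<le> \<eta> * v"
      using v \<eta> by (intro mult_left_mono) auto
    ultimately show ?thesis
      using uv(1) by (simp add: algebra_simps)
  qed
  moreover have "- (r * (Z + k)) \<le> v"
  proof -
    have "0 \<le> \<eta> * Z" using \<eta> Z by simp
    then have "\<eta> * U \<le> k" using \<eta>(3) by (simp add: algebra_simps)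
    then have "r * (Z + \<eta> * U) \<le> r * (Z + k)"
      using r by (intro mult_left_mono) auto
    then show ?thesis using v by linarith
  qed
  ultimately show "max (a1 * u + b1 * v) (a4 * u + b4 * v) + k * r
      \<le> max (a2 * u + b2 * v) (a3 * u + b3 * v)"
    by (intro side_dominance[OF a b k(1,2)]) (use k(3) r(1) in auto)
qed

text \<open>
  With \<open>U = 1\<close> and equality in place of the inequalities for \<open>V\<close>, \<open>W\<close> and \<open>Z\<close>, the remaining
  inequality is the one for the product. A small \<open>e\<close> added in each step makes all of them strict and
  the four numbers positive even if some \<open>c\<close> vanishes.
\<close>

lemma cyclic_ratios:
  fixes c1 c2 c3 c4 d1 d2 d3 d4 :: real
  assumes c: "0 \<le> c1" "0 \<le> c2" "0 \<le> c3" "0 \<le> c4"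
    and d: "0 < d1" "0 < d2" "0 < d3" "0 < d4"
    and prod: "c1 * c2 * c3 * c4 < d1 * d2 * d3 * d4"
  shows "\<exists>U V W Z. 0 < U \<and> 0 < V \<and> 0 < W \<and> 0 < Z \<and>
    c1 * Z < d1 * U \<and> c2 * U < d2 * V \<and> c3 * V < d3 * W \<and> c4 * W < d4 * Z"
proof -
  define V where "V = (\<lambda>e. (c2 + e) / d2)"
  define W where "W = (\<lambda>e. (c3 * V e + e) / d3)"
  define Z where "Z = (\<lambda>e. (c4 * W e + e) / d4)"
  have "((\<lambda>e. c1 * Z e) \<longlongrightarrow> c1 * ((c4 * ((c3 * ((c2 + 0) / d2) + 0) / d3) + 0) / d4)) (at_right 0)"
    unfolding V_def W_def Z_def by (intro tendsto_intros) (use d in auto)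
  moreover have "c1 * ((c4 * ((c3 * ((c2 + 0) / d2) + 0) / d3) + 0) / d4) < d1"
    using prod d by (simp add: divide_simps mult_ac)
  ultimately have "\<forall>\<^sub>F e in at_right 0. c1 * Z e < d1"
    by (rule order_tendstoD)
  then have "\<forall>\<^sub>F e in at_right 0. c1 * Z e < d1 \<and> 0 < e"
    using eventually_at_right_less by (rule eventually_conj)
  then obtain e where e: "c1 * Z e < d1" "0 < e"
    using eventually_happens'[OF trivial_limit_at_right_real] by blast
  have V: "0 < V e" "d2 * V e = c2 + e"
    using c d e by (auto simp: V_def intro!: divide_pos_pos add_nonneg_pos)
  have W: "0 < W e" "d3 * W e = c3 * V e + e"
    using c d e V(1) by (auto simp: W_def intro!: divide_pos_pos add_nonneg_pos)
  have Z: "0 < Z e" "d4 * Z e = c4 * W e + e"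
    using c d e W(1) by (auto simp: Z_def intro!: divide_pos_pos add_nonneg_pos)
  show ?thesis
    by (rule exI[of _ 1], rule exI[of _ "V e"], rule exI[of _ "W e"], rule exI[of _ "Z e"])
      (use V W Z e in auto)
qed

lemma shrink_margin:
  fixes c d g U Z :: real
  assumes "0 < g" "0 < U" "c * Z < d * U"
  shows "\<forall>\<^sub>F k in at_right 0. k \<le> d * (U - k) - c * (Z + k) \<and> k \<le> g * (U - k) \<and> k \<le> U"
proof -
  have "((\<lambda>k. d * (U - k) - c * (Z + k) - k) \<longlongrightarrow> d * (U - 0) - c * (Z + 0) - 0) (at_right 0)"
    "((\<lambda>k. g * (U - k) - k) \<longlongrightarrow> g * (U - 0) - 0) (at_right 0)"
    by (intro tendsto_intros)+
  then have "\<forall>\<^sub>F k in at_right 0. 0 < d * (U - k) - c * (Z + k) - k"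
    "\<forall>\<^sub>F k in at_right 0. 0 < g * (U - k) - k"
    using assms by (auto dest!: order_tendstoD(1)[where a = 0])
  moreover have "\<forall>\<^sub>F k in at_right 0. k < U"
    by (rule order_tendstoD(2)[OF tendsto_ident_at assms(2)])
  ultimately show ?thesis
    by eventually_elim auto
qed

lemma inner_vec2: "(vector [x, y] :: real^2) \<bullet> p = x * p$1 + y * p$2"
  by (simp add: inner_vec_def sum_2)

text \<open>
  The outward normals of the right, top, left and bottom sides, scaled so that the sides of the polygon
  of level \<open>c\<close> have distances \<open>c * U\<close>, \<open>c * V\<close>, \<open>c * W\<close>, \<open>c * Z\<close> from the origin when \<open>\<eta> = 0\<close>.
\<close>

definition tilted_box :: "real \<Rightarrow> real \<Rightarrow> real \<Rightarrow> real \<Rightarrow> real \<Rightarrow> (real^2) set"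
  where "tilted_box \<eta> U V W Z =
    {vector [1 / U, - \<eta> / U], vector [\<eta> / V, 1 / V], vector [- 1 / W, \<eta> / W], vector [- \<eta> / Z, - 1 / Z]}"

lemma mem_tilted_box:
  assumes "0 < U" "0 < V" "0 < W" "0 < Z"
  shows "p \<in> polygon (tilted_box \<eta> U V W Z) c \<longleftrightarrow>
    p$1 - \<eta> * p$2 \<le> c * U \<and> \<eta> * p$1 + p$2 \<le> c * V \<and>
    - (c * W) \<le> p$1 - \<eta> * p$2 \<and> - (c * Z) \<le> \<eta> * p$1 + p$2"
  using assms by (auto simp: mem_polygon tilted_box_def inner_vec2 field_simps)

lemma bounded_tilted_box:
  assumes pos: "0 < U" "0 < V" "0 < W" "0 < Z" and \<eta>: "0 \<le> \<eta>" "\<eta> \<le> 1"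
  shows "bounded (polygon (tilted_box \<eta> U V W Z) c)"
proof -
  define M where "M = \<bar>c\<bar> * (U + V + W + Z)"
  have "norm p \<le> 4 * M" if p: "p \<in> polygon (tilted_box \<eta> U V W Z) c" for p
  proof -
    define x y where "x = p$1 - \<eta> * p$2" and "y = \<eta> * p$1 + p$2"
    have M: "\<bar>c\<bar> * U \<le> M" "\<bar>c\<bar> * V \<le> M" "\<bar>c\<bar> * W \<le> M" "\<bar>c\<bar> * Z \<le> M"
      using pos unfolding M_def by (auto intro!: mult_left_mono)
    have "c * s \<le> \<bar>c\<bar> * s" if "0 < s" for s
      using that by (intro mult_right_mono) auto
    note this[OF pos(1)] this[OF pos(2)] this[OF pos(3)] this[OF pos(4)]
    then have "\<bar>x\<bar> \<le> M" "\<bar>y\<bar> \<le> M"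
      using p M unfolding mem_tilted_box[OF pos] x_def[symmetric] y_def[symmetric] abs_le_iff
      by linarith+
    then have \<eta>xy: "\<bar>\<eta> * x\<bar> \<le> M" "\<bar>\<eta> * y\<bar> \<le> M"
      using \<eta> by (auto simp: abs_mult intro: mult_left_le_one_le[THEN order_trans])
    have le: "\<bar>s\<bar> \<le> \<bar>(1 + \<eta> * \<eta>) * s\<bar>" for s :: real
      unfolding abs_mult using mult_right_mono[of 1 "\<bar>1 + \<eta> * \<eta>\<bar>" "\<bar>s\<bar>"] by simp
    have "(1 + \<eta> * \<eta>) * p$1 = x + \<eta> * y" "(1 + \<eta> * \<eta>) * p$2 = y - \<eta> * x"
      by (auto simp: x_def y_def algebra_simps)
    then have "\<bar>p$1\<bar> \<le> 2 * M" "\<bar>p$2\<bar> \<le> 2 * M"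
      using le[of "p$1"] le[of "p$2"] \<open>\<bar>x\<bar> \<le> M\<close> \<open>\<bar>y\<bar> \<le> M\<close> \<eta>xy by linarith+
    then show ?thesis
      using norm_le_l1_cart[of p] by (simp add: sum_2)
  qed
  then show ?thesis
    unfolding bounded_iff by blast
qed

section \<open>Permanence of the exponential field\<close>

lemma lipschitz_exp_linear:
  fixes K :: "(real^2) set"
  assumes "compact K"
  shows "\<exists>L. L-lipschitz_on K (\<lambda>p. exp (a * p$1 + b * p$2))"
proof -
  define l where "l = (\<lambda>p::real^2. a * p$1 + b * p$2)"
  have bl: "bounded_linear l"
    unfolding l_def
    by (intro bounded_linear_add bounded_linear_const_mult bounded_linear_vec_nth)
  obtain B where B: "B-lipschitz_on K l"
    using bounded_linear.lipschitz_boundE[OF bl] by metis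
  have "bounded (l ` K)"
    using assms B by (intro compact_imp_bounded compact_continuous_image lipschitz_on_continuous_on)
  then obtain M where M: "\<And>p. p \<in> K \<Longrightarrow> \<bar>l p\<bar> \<le> M"
    by (auto simp: bounded_iff)
  have "(exp M)-lipschitz_on {-M..M} exp"
  proof (rule bounded_derivative_imp_lipschitz)
    show "(exp has_derivative (\<lambda>h. exp x * h)) (at x within {-M..M})" for x :: real
      by (auto intro!: derivative_eq_intros)
    show "onorm (\<lambda>h. exp x * h) \<le> exp M" if "x \<in> {-M..M}" for x :: real
      using that by (intro onorm_le) (auto simp: abs_mult intro: mult_right_mono)
  qed auto
  moreover have "l ` K \<subseteq> {-M..M}"
    using M by (force simp: abs_le_iff)
  ultimately have "(exp M * B)-lipschitz_on K (\<lambda>p. exp (l p))"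
    using B by (intro lipschitz_on_compose2) (auto intro: lipschitz_on_subset)
  then show ?thesis
    unfolding l_def by blast
qed

lemma exp_field_lipschitz_on_compact:
  assumes K: "compact K"
  shows "\<exists>L. L-lipschitz_on K (exp_field a1 a2 a3 a4 b1 b2 b3 b4)"
proof -
  let ?f = "exp_field a1 a2 a3 a4 b1 b2 b3 b4"
  obtain L1 L2 L3 L4 where L:
    "L1-lipschitz_on K (\<lambda>p. exp (a1 * p$1 + b1 * p$2))"
    "L2-lipschitz_on K (\<lambda>p. exp (a2 * p$1 + b2 * p$2))"
    "L3-lipschitz_on K (\<lambda>p. exp (a3 * p$1 + b3 * p$2))"
    "L4-lipschitz_on K (\<lambda>p. exp (a4 * p$1 + b4 * p$2))"
    using lipschitz_exp_linear[OF K, of a1 b1] lipschitz_exp_linear[OF K, of a2 b2]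
      lipschitz_exp_linear[OF K, of a3 b3] lipschitz_exp_linear[OF K, of a4 b4] by blast
  have comps: "(L1 + L2)-lipschitz_on K (\<lambda>p. ?f p $ 1)" "(L3 + L4)-lipschitz_on K (\<lambda>p. ?f p $ 2)"
    unfolding exp_field_def vector_2
    by (rule lipschitz_on_diff[OF L(1,2)], rule lipschitz_on_diff[OF L(3,4)])
  have "((L1 + L2) + (L3 + L4))-lipschitz_on K ?f"
  proof (rule lipschitz_onI)
    fix p q assume pq: "p \<in> K" "q \<in> K"
    have "dist (?f p) (?f q) \<le> (\<Sum>i\<in>UNIV. \<bar>(?f p - ?f q) $ i\<bar>)"
      unfolding dist_norm by (rule norm_le_l1_cart)
    also have "\<dots> = dist (?f p $ 1) (?f q $ 1) + dist (?f p $ 2) (?f q $ 2)"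
      by (simp add: sum_2 dist_real_def)
    also have "\<dots> \<le> (L1 + L2) * dist p q + (L3 + L4) * dist p q"
      using pq by (intro add_mono lipschitz_onD[OF comps(1)] lipschitz_onD[OF comps(2)])
    finally show "dist (?f p) (?f q) \<le> ((L1 + L2) + (L3 + L4)) * dist p q"
      by (simp add: distrib_right)
  qed (use comps[THEN lipschitz_on_nonneg] in linarith)
  then show ?thesis by blast
qed

text \<open>
  The strict inequality of the two products forces the denominators of the four ratios to be positive,
  whereas the numerators may vanish. The four corner inequalities say which of the two motions dominates at the
  corners of the box: vertical at the lower right and upper left, horizontal at the other two.
\<close>

lemma crosses_inward_counterclockwise:
  fixes a1 a2 a3 a4 b1 b2 b3 b4 :: real
  assumes a: "a4 \<le> min a1 a2" "max a1 a2 \<le> a3" and b: "b1 \<le> min b3 b4" "max b3 b4 \<le> b2"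
    and L: "(b1 - b3) * (a2 - a3) * (b4 - b2) * (a4 - a1) < (a3 - a1) * (b2 - b3) * (a2 - a4) * (b4 - b1)"
  shows "\<exists>N R. 0 \<le> R \<and> crosses_inward (exp_field a1 a2 a3 a4 b1 b2 b3 b4) N R"
proof -
  have a': "a4 \<le> a1" "a4 \<le> a2" "a1 \<le> a3" "a2 \<le> a3" and b': "b1 \<le> b3" "b1 \<le> b4" "b3 \<le> b2" "b4 \<le> b2"
    using a b by auto
  have c: "0 \<le> b3 - b1" "0 \<le> a3 - a2" "0 \<le> b2 - b4" "0 \<le> a1 - a4"
    using a' b' by auto
  have "(b1 - b3) * (a2 - a3) * (b4 - b2) * (a4 - a1) = (b3 - b1) * (a3 - a2) * (b2 - b4) * (a1 - a4)"
    by (simp add: algebra_simps)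
  then have prod: "(b3 - b1) * (a3 - a2) * (b2 - b4) * (a1 - a4)
      < (a3 - a1) * (b2 - b3) * (a2 - a4) * (b4 - b1)"
    using L by (rule ord_eq_less_trans[OF sym])
  moreover have "0 \<le> (b3 - b1) * (a3 - a2) * (b2 - b4) * (a1 - a4)"
    using c by (intro mult_nonneg_nonneg)
  ultimately have "(a3 - a1) * (b2 - b3) * (a2 - a4) * (b4 - b1) \<noteq> 0"
    by linarith
  then have "a3 - a1 \<noteq> 0 \<and> b2 - b3 \<noteq> 0 \<and> a2 - a4 \<noteq> 0 \<and> b4 - b1 \<noteq> 0"
    unfolding mult_eq_0_iff by blast
  then have d: "0 < a3 - a1" "0 < b2 - b3" "0 < a2 - a4" "0 < b4 - b1"
    using a' b' by linarith+
  obtain U V W Z where pos: "0 < U" "0 < V" "0 < W" "0 < Z"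
    and corners: "(b3 - b1) * Z < (a3 - a1) * U" "(a3 - a2) * U < (b2 - b3) * V"
      "(b2 - b4) * V < (a2 - a4) * W" "(a1 - a4) * W < (b4 - b1) * Z"
    using cyclic_ratios[OF c d prod] by blast
  note margins =
    shrink_margin[OF d(3) pos(1) corners(1)] shrink_margin[OF d(4) pos(2) corners(2)]
    shrink_margin[OF d(1) pos(3) corners(3)] shrink_margin[OF d(2) pos(4) corners(4)]
    eventually_at_right_less[of "0::real"]
  obtain k where k: "0 < k"
      "k \<le> (a3 - a1) * (U - k) - (b3 - b1) * (Z + k)" "k \<le> (a2 - a4) * (U - k)" "k \<le> U"
      "k \<le> (b2 - b3) * (V - k) - (a3 - a2) * (U + k)" "k \<le> (b4 - b1) * (V - k)" "k \<le> V"
      "k \<le> (a2 - a4) * (W - k) - (b2 - b4) * (V + k)" "k \<le> (a3 - a1) * (W - k)" "k \<le> W"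
      "k \<le> (b4 - b1) * (Z - k) - (a1 - a4) * (W + k)" "k \<le> (b2 - b3) * (Z - k)" "k \<le> Z"
    using eventually_happens'[OF trivial_limit_at_right_real
        margins(1)[THEN eventually_conj, OF margins(2)[THEN eventually_conj,
        OF margins(3)[THEN eventually_conj, OF margins(4)[THEN eventually_conj, OF margins(5)]]]]]
    by (elim exE conjE)
  define \<eta> where "\<eta> = min 1 (k / (U + V + W + Z))"
  have \<eta>: "0 < \<eta>" "\<eta> \<le> 1"
    using k pos by (auto simp: \<eta>_def)
  have tilt: "\<eta> * s \<le> k" if "s \<le> U + V + W + Z" for s
  proof -
    have "\<eta> * s \<le> \<eta> * (U + V + W + Z)"
      using that \<eta> by (intro mult_left_mono) auto
    also have "\<dots> \<le> k / (U + V + W + Z) * (U + V + W + Z)"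
      using pos by (intro mult_right_mono) (auto simp: \<eta>_def)
    finally show ?thesis using pos by simp
  qed
  \<comment> \<open>Beyond this level the exponential gap between the monomials outweighs the factor \<open>\<eta>\<close>; any
      constant above 2 in place of 3 would do.\<close>
  define R where "R = ln (3 / \<eta>) / k"
  have R: "0 \<le> R"
    using \<eta> k(1) by (simp add: R_def)
  have gap: "2 < \<eta> * exp (k * r)" if "R \<le> r" for r
  proof -
    have "ln (3 / \<eta>) \<le> k * r"
      using that k(1) by (simp add: R_def field_simps)
    then have "exp (ln (3 / \<eta>)) \<le> exp (k * r)"
      by (simp only: exp_le_cancel_iff)
    then have "3 / \<eta> \<le> exp (k * r)"
      using \<eta> by simp
    then show ?thesis using \<eta> by (simp add: field_simps)
  qed
  let ?f = "exp_field a1 a2 a3 a4 b1 b2 b3 b4" and ?N = "tilted_box \<eta> U V W Z"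
  have "n \<bullet> ?f p < 0" if r: "R \<le> r" and p: "p \<in> polygon ?N r" and n: "n \<in> ?N" "n \<bullet> p = r" for r p n
  proof -
    let ?e = "\<lambda>a b. exp (a * p$1 + b * p$2)"
    note box = p[unfolded mem_tilted_box[OF pos]]
    have r0: "0 \<le> r" using r R by simp
    note inward = tilted_side_inward[OF _ _ _ _ _ _ _ _ _ _ _ \<eta> _ r0 gap[OF r]]
    consider "n = vector [1 / U, - \<eta> / U]" | "n = vector [\<eta> / V, 1 / V]"
      | "n = vector [- 1 / W, \<eta> / W]" | "n = vector [- \<eta> / Z, - 1 / Z]"
      using n(1) by (auto simp: tilted_box_def)
    then show ?thesis
    proof cases
      case 1
      have "p$1 - \<eta> * p$2 = r * U"
        using n(2) pos by (simp add: 1 inner_vec2 field_simps)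
      moreover have "- (r * Z) \<le> \<eta> * p$1 + p$2"
        using box by linarith
      ultimately have "(exp (a1 * p$1 + b1 * p$2) - exp (a2 * p$1 + b2 * p$2))
          - \<eta> * (exp (a3 * p$1 + b3 * p$2) - exp (a4 * p$1 + b4 * p$2)) < 0"
        by (intro inward[where U = U and Z = Z]) (simp_all add: a' b' k pos less_imp_le tilt)
      then have "((?e a1 b1 - ?e a2 b2) - \<eta> * (?e a3 b3 - ?e a4 b4)) / U < 0"
        using pos by (intro divide_neg_pos) (simp_all add: add.commute)
      also have "((?e a1 b1 - ?e a2 b2) - \<eta> * (?e a3 b3 - ?e a4 b4)) / U = n \<bullet> ?f p"
        using pos by (simp add: 1 inner_vec2 exp_field_def field_simps)
      finally show ?thesis .
    next
      case 2
      \<comment> \<open>Coordinates \<open>(v, -u)\<close>: the second equation takes the place of the first one.\<close>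
      have "p$2 - \<eta> * (- p$1) = r * V"
        using n(2) pos by (simp add: 2 inner_vec2 field_simps)
      moreover have "- (r * U) \<le> \<eta> * p$2 + (- p$1)"
        using box by linarith
      ultimately have "(exp (b3 * p$2 + (- a3) * (- p$1)) - exp (b4 * p$2 + (- a4) * (- p$1)))
          - \<eta> * (exp (b2 * p$2 + (- a2) * (- p$1)) - exp (b1 * p$2 + (- a1) * (- p$1))) < 0"
        by (intro inward[where U = V and Z = U]) (simp_all add: a' b' k pos less_imp_le tilt)
      then have "((?e a3 b3 - ?e a4 b4) - \<eta> * (?e a2 b2 - ?e a1 b1)) / V < 0"
        using pos by (intro divide_neg_pos) (simp_all add: add.commute)
      also have "((?e a3 b3 - ?e a4 b4) - \<eta> * (?e a2 b2 - ?e a1 b1)) / V = n \<bullet> ?f p"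
        using pos by (simp add: 2 inner_vec2 exp_field_def field_simps)
      finally show ?thesis .
    next
      case 3
      \<comment> \<open>Coordinates \<open>(-u, -v)\<close>: the terms of each equation change places.\<close>
      have "- p$1 - \<eta> * (- p$2) = r * W"
        using n(2) pos by (simp add: 3 inner_vec2 field_simps)
      moreover have "- (r * V) \<le> \<eta> * (- p$1) + (- p$2)"
        using box by linarith
      ultimately have "(exp ((- a2) * (- p$1) + (- b2) * (- p$2)) - exp ((- a1) * (- p$1) + (- b1) * (- p$2)))
          - \<eta> * (exp ((- a4) * (- p$1) + (- b4) * (- p$2)) - exp ((- a3) * (- p$1) + (- b3) * (- p$2))) < 0"
        by (intro inward[where U = W and Z = V]) (simp_all add: a' b' k pos less_imp_le tilt)
      then have "((?e a2 b2 - ?e a1 b1) - \<eta> * (?e a4 b4 - ?e a3 b3)) / W < 0"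
        using pos by (intro divide_neg_pos) (simp_all add: add.commute)
      also have "((?e a2 b2 - ?e a1 b1) - \<eta> * (?e a4 b4 - ?e a3 b3)) / W = n \<bullet> ?f p"
        using pos by (simp add: 3 inner_vec2 exp_field_def field_simps)
      finally show ?thesis .
    next
      case 4
      \<comment> \<open>Coordinates \<open>(-v, u)\<close>.\<close>
      have "- p$2 - \<eta> * p$1 = r * Z"
        using n(2) pos by (simp add: 4 inner_vec2 field_simps)
      moreover have "- (r * W) \<le> \<eta> * (- p$2) + p$1"
        using box by linarith
      ultimately have "(exp ((- b4) * (- p$2) + a4 * p$1) - exp ((- b3) * (- p$2) + a3 * p$1))
          - \<eta> * (exp ((- b1) * (- p$2) + a1 * p$1) - exp ((- b2) * (- p$2) + a2 * p$1)) < 0"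
        by (intro inward[where U = Z and Z = W]) (simp_all add: a' b' k pos less_imp_le tilt)
      then have "((?e a4 b4 - ?e a3 b3) - \<eta> * (?e a1 b1 - ?e a2 b2)) / Z < 0"
        using pos by (intro divide_neg_pos) (simp_all add: add.commute)
      also have "((?e a4 b4 - ?e a3 b3) - \<eta> * (?e a1 b1 - ?e a2 b2)) / Z = n \<bullet> ?f p"
        using pos by (simp add: 4 inner_vec2 exp_field_def field_simps)
      finally show ?thesis .
    qed
  qed
  moreover have "finite ?N"
    by (simp add: tilted_box_def)
  moreover have "bounded (polygon ?N c)" for c
    using \<eta> by (intro bounded_tilted_box pos) auto
  ultimately have "crosses_inward ?f ?N R"
    unfolding crosses_inward_def by blast
  then show ?thesis
    using R by blast
qed

lemma crosses_inward_clockwise: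
  fixes a1 a2 a3 a4 b1 b2 b3 b4 :: real
  assumes a: "a3 \<le> min a1 a2" "max a1 a2 \<le> a4" and b: "b2 \<le> min b3 b4" "max b3 b4 \<le> b1"
    and L: "(a3 - a1) * (b2 - b3) * (a2 - a4) * (b4 - b1) < (b1 - b3) * (a2 - a3) * (b4 - b2) * (a4 - a1)"
  shows "\<exists>N R. 0 \<le> R \<and> crosses_inward (exp_field a1 a2 a3 a4 b1 b2 b3 b4) N R"
proof -
  let ?g = "exp_field (- a2) (- a1) (- a3) (- a4) b2 b1 b3 b4"
  define \<rho> where "\<rho> = (\<lambda>p::real^2. vector [- p$1, p$2] :: real^2)"
  have "(- a3 - - a2) * (b1 - b3) * (- a1 - - a4) * (b4 - b2) = (b1 - b3) * (a2 - a3) * (b4 - b2) * (a4 - a1)"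
    "(b2 - b3) * (- a1 - - a3) * (b4 - b1) * (- a4 - - a2) = (a3 - a1) * (b2 - b3) * (a2 - a4) * (b4 - b1)"
    by (simp_all add: mult_ac)
  then have "\<exists>N R. 0 \<le> R \<and> crosses_inward ?g N R"
    using a b L by (intro crosses_inward_counterclockwise) linarith+
  then obtain N R where "0 \<le> R" and cross: "crosses_inward ?g N R"
    by blast
  have "crosses_inward (exp_field a1 a2 a3 a4 b1 b2 b3 b4) (\<rho> ` N) R"
  proof (rule crosses_inward_conjugate[OF cross])
    show "linear \<rho>"
      by (rule linearI) (auto simp: \<rho>_def vec_eq_iff forall_2)
  qed (auto simp: \<rho>_def vec_eq_iff forall_2 inner_vec_def sum_2 exp_field_def)
  then show ?thesis
    using \<open>0 \<le> R\<close> by blast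
qed

lemma exp_field_uminus:
  "- exp_field a1 a2 a3 a4 b1 b2 b3 b4 p = exp_field a2 a1 a4 a3 b2 b1 b4 b3 p"
  by (simp add: exp_field_def vec_eq_iff forall_2)

theorem theorem3p3:
  fixes a1 a2 a3 a4 b1 b2 b3 b4 L_inf :: real
    and f :: "real^2 \<Rightarrow> real^2"
    and J :: "real^2^2"
  defines "f \<equiv> exp_field a1 a2 a3 a4 b1 b2 b3 b4"
    and "J \<equiv> exp_field_jacobian a1 a2 a3 a4 b1 b2 b3 b4"
  assumes "det J > 0"
    and "(sgn (J$1$2) = -1 \<and> sgn (J$2$1) = 1 \<and>
          a4 \<le> min a1 a2 \<and> max a1 a2 \<le> a3 \<and>
          b1 \<le> min b3 b4 \<and> max b3 b4 \<le> b2 \<and>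
          L_inf = (a3 - a1) * (b2 - b3) * (a2 - a4) * (b4 - b1)
                - (b1 - b3) * (a2 - a3) * (b4 - b2) * (a4 - a1))
       \<or> (sgn (J$1$2) = 1 \<and> sgn (J$2$1) = -1 \<and>
          a3 \<le> min a1 a2 \<and> max a1 a2 \<le> a4 \<and>
          b2 \<le> min b3 b4 \<and> max b3 b4 \<le> b1 \<and>
          L_inf = (b1 - b3) * (a2 - a3) * (b4 - b2) * (a4 - a1)
                - (a3 - a1) * (b2 - b3) * (a2 - a4) * (b4 - b1))"
  shows "(L_inf > 0 \<longrightarrow> permanent f) \<and> (L_inf < 0 \<longrightarrow> \<not> permanent f)"
proof (intro conjI impI)
  assume L: "L_inf > 0"
  have "\<exists>N R. 0 \<le> R \<and> crosses_inward f N R"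
    using assms(4) unfolding f_def
  proof (elim disjE conjE)
    assume "a4 \<le> min a1 a2" "max a1 a2 \<le> a3" "b1 \<le> min b3 b4" "max b3 b4 \<le> b2"
      "L_inf = (a3 - a1) * (b2 - b3) * (a2 - a4) * (b4 - b1)
        - (b1 - b3) * (a2 - a3) * (b4 - b2) * (a4 - a1)"
    then show "\<exists>N R. 0 \<le> R \<and> crosses_inward (exp_field a1 a2 a3 a4 b1 b2 b3 b4) N R"
      using L by (intro crosses_inward_counterclockwise) linarith+
  next
    assume "a3 \<le> min a1 a2" "max a1 a2 \<le> a4" "b2 \<le> min b3 b4" "max b3 b4 \<le> b1"
      "L_inf = (b1 - b3) * (a2 - a3) * (b4 - b2) * (a4 - a1)
        - (a3 - a1) * (b2 - b3) * (a2 - a4) * (b4 - b1)"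
    then show "\<exists>N R. 0 \<le> R \<and> crosses_inward (exp_field a1 a2 a3 a4 b1 b2 b3 b4) N R"
      using L by (intro crosses_inward_clockwise) linarith+
  qed
  then show "permanent f"
    using permanent_if_crosses_inward[OF _ _ exp_field_lipschitz_on_compact] unfolding f_def by blast
next
  assume L: "L_inf < 0"
  have sign: "(a4 - a2) * (b1 - b4) * (a1 - a3) * (b3 - b2) = (a3 - a1) * (b2 - b3) * (a2 - a4) * (b4 - b1)"
    "(b2 - b4) * (a1 - a4) * (b3 - b1) * (a3 - a2) = (b1 - b3) * (a2 - a3) * (b4 - b2) * (a4 - a1)"
    by (simp_all add: algebra_simps)
  have "\<exists>N R. 0 \<le> R \<and> crosses_inward (exp_field a2 a1 a4 a3 b2 b1 b4 b3) N R"
    using assms(4)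
  proof (elim disjE conjE)
    assume "a4 \<le> min a1 a2" "max a1 a2 \<le> a3" "b1 \<le> min b3 b4" "max b3 b4 \<le> b2"
      "L_inf = (a3 - a1) * (b2 - b3) * (a2 - a4) * (b4 - b1)
        - (b1 - b3) * (a2 - a3) * (b4 - b2) * (a4 - a1)"
    then show ?thesis
      using L sign by (intro crosses_inward_clockwise) linarith+
  next
    assume "a3 \<le> min a1 a2" "max a1 a2 \<le> a4" "b2 \<le> min b3 b4" "max b3 b4 \<le> b1"
      "L_inf = (b1 - b3) * (a2 - a3) * (b4 - b2) * (a4 - a1)
        - (a3 - a1) * (b2 - b3) * (a2 - a4) * (b4 - b1)"
    then show ?thesis
      using L sign by (intro crosses_inward_counterclockwise) linarith+
  qed
  then show "\<not> permanent f"
    using not_permanent_if_crosses_outward[of f] unfolding f_def exp_field_uminus by blast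
qed

end
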